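(* Consider routing a single provider to the client, with true (supermodular) route cost $T(\mathscr{S},\mathcal{R})=\sum_{e\in\mathcal{R}}w_e(\mathscr{S})$ and modular surrogate cost $\widetilde{T}(\mathscr{S},\mathcal{R})=\sum_{e\in\mathcal{R}}\widetilde{w}_e(\mathscr{S})$, where for each edge $e$ $$w_e(\mathscr{S})=\widetilde{w}_e(\mathscr{S})+\Delta_e(\mathscr{S}),\qquad 0\le\Delta_e(\mathscr{S})\le\delta.$$ Let $\widetilde{\mathcal{R}}^\star$ be an optimal (minimum-cost) route under $\widetilde{T}$, and let $\mathcal{R}^\star$ be an optimal route under $T$. Then, for any fixed $\mathscr{S}$, $$\widetilde{T}(\mathscr{S},\widetilde{\mathcal{R}}^\star)\;\le\;T(\mathscr{S},\mathcal{R}^\star)\;\le\;\widetilde{T}(\mathscr{S},\widetilde{\mathcal{R}}^\star)+\delta\,|\widetilde{\mathcal{R}}^\star|.$$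
   Context: Routes $\mathcal{R}$ range over a finite non-empty set of directed simple paths from the provider's node to the client's node in a finite directed graph; a route is viewed as a set of edges and $|\mathcal{R}|$ is its number of edges. $\mathscr{S}$ is an allocation (a partition of a finite item set among providers), and edge costs may depend on it. $\delta$ is the routing modular deviation, i.e. the maximum over feasible allocations, routes and their edges of $w_e-\widetilde{w}_e$. Optimality of the routes is for the given fixed $\mathscr{S}$. *)

theory Defs
  imports
    Complex_Main
    "HOL-Library.FuncSet"
    "HOL-Library.Disjoint_Sets"
    "Graph_Theory.Arc_Walk"
begin

(* Providers may receive no items. Extensionality makes two allocations equal as soon as they
   agree on the providers, and makes the set of allocations finite. *)
definition allocations :: "'p set \<Rightarrow> 'i set \<Rightarrow> ('p \<Rightarrow> 'i set) set" where
  "allocations P D =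
     {S \<in> P \<rightarrow>\<^sub>E Pow D. disjoint_family_on S P \<and> (\<Union>p\<in>P. S p) = D}"

definition is_route :: "('v, 'e) pre_digraph \<Rightarrow> 'v \<Rightarrow> 'v \<Rightarrow> 'e set \<Rightarrow> bool" where
  "is_route G u v R \<longleftrightarrow> (\<exists>p. pre_digraph.apath G u p v \<and> R = set p)"

definition route_cost ::
  "('e \<Rightarrow> ('p \<Rightarrow> 'i set) \<Rightarrow> real) \<Rightarrow> ('p \<Rightarrow> 'i set) \<Rightarrow> 'e set \<Rightarrow> real" where
  "route_cost w S R = (\<Sum>e\<in>R. w e S)"

abbreviation optimal_route ::
  "('e \<Rightarrow> ('p \<Rightarrow> 'i set) \<Rightarrow> real) \<Rightarrow> ('p \<Rightarrow> 'i set) \<Rightarrow> 'e set set \<Rightarrow> 'e set \<Rightarrow> bool" where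
  "optimal_route w S Rs R \<equiv> is_arg_min (route_cost w S) (\<lambda>R'. R' \<in> Rs) R"

(* The maximum is over a finite set whenever F consists of allocations of finitely many items to
   finitely many providers and Rs of routes. That set is empty, and the value unspecified, only
   if there is no allocation or no route has an edge. *)
definition routing_modular_deviation ::
  "('p \<Rightarrow> 'i set) set \<Rightarrow> 'e set set \<Rightarrow> ('e \<Rightarrow> ('p \<Rightarrow> 'i set) \<Rightarrow> real)
    \<Rightarrow> ('e \<Rightarrow> ('p \<Rightarrow> 'i set) \<Rightarrow> real) \<Rightarrow> real" where
  "routing_modular_deviation F Rs w wt =
     Max {w e S - wt e S | S R e. S \<in> F \<and> R \<in> Rs \<and> e \<in> R}"

end

theory Submission
  imports Defs
begin

text \<open>
  The surrogate underestimates each edge cost, by at most \<open>\<delta>\<close>. Summed along a route, this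
  places the true cost of every candidate route between its surrogate cost and its surrogate
  cost plus \<open>\<delta>\<close> per edge. Two comparisons then suffice. The lower bound is read off at
  the truly optimal route, whose surrogate cost is at least the surrogate minimum. The upper
  bound is read off at the surrogate-optimal route, whose true cost is at least the true
  minimum; this is why the error term counts the edges of the surrogate-optimal route.
\<close>

lemma route_cost_mono:
  assumes "\<And>e. e \<in> R \<Longrightarrow> wt e S \<le> w e S"
  shows "route_cost wt S R \<le> route_cost w S R"
  unfolding route_cost_def by (rule sum_mono) (rule assms)

lemma route_cost_le_add_card:
  assumes "\<And>e. e \<in> R \<Longrightarrow> w e S \<le> wt e S + \<delta>"
  shows "route_cost w S R \<le> route_cost wt S R + \<delta> * real (card R)"
proof -
  have "route_cost w S R \<le> (\<Sum>e\<in>R. wt e S + \<delta>)"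
    unfolding route_cost_def by (rule sum_mono) (rule assms)
  also have "\<dots> = route_cost wt S R + \<delta> * real (card R)"
    by (simp add: route_cost_def sum.distrib mult.commute)
  finally show ?thesis .
qed

theorem mainTheorem6:
  fixes G :: "('v, 'e) pre_digraph"
    and P :: "'p set" and D :: "'i set"
    and node :: "'p \<Rightarrow> 'v" and i :: 'p and client :: 'v
    and F :: "('p \<Rightarrow> 'i set) set" and S :: "'p \<Rightarrow> 'i set"
    and Rs :: "'e set set" and Rt_opt R_opt :: "'e set"
    and w wt \<Delta> :: "'e \<Rightarrow> ('p \<Rightarrow> 'i set) \<Rightarrow> real" and \<delta> :: real
  assumes graph: "fin_digraph G"
    and providers: "finite P" "i \<in> P"
    and items: "finite D"
    and nodes: "node i \<in> verts G" "client \<in> verts G"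
    and routes: "finite Rs" "Rs \<noteq> {}" "\<And>R. R \<in> Rs \<Longrightarrow> is_route G (node i) client R"
    and feasible: "F \<subseteq> allocations P D"
    and delta: "\<delta> = routing_modular_deviation F Rs w wt"
    and decomposition: "\<And>e S'. e \<in> \<Union>Rs \<Longrightarrow> S' \<in> F \<Longrightarrow> w e S' = wt e S' + \<Delta> e S'"
    and deviation_nonneg: "\<And>e S'. e \<in> \<Union>Rs \<Longrightarrow> S' \<in> F \<Longrightarrow> 0 \<le> \<Delta> e S'"
    and deviation_le: "\<And>e S'. e \<in> \<Union>Rs \<Longrightarrow> S' \<in> F \<Longrightarrow> \<Delta> e S' \<le> \<delta>"
    and S: "S \<in> F"
    and surrogate_opt: "optimal_route wt S Rs Rt_opt"
    and true_opt: "optimal_route w S Rs R_opt"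
  shows "route_cost wt S Rt_opt \<le> route_cost w S R_opt
       \<and> route_cost w S R_opt \<le> route_cost wt S Rt_opt + \<delta> * real (card Rt_opt)"
proof
  have mem: "Rt_opt \<in> Rs" "R_opt \<in> Rs"
    using surrogate_opt true_opt by (simp_all add: is_arg_min_def)
  have lower: "wt e S \<le> w e S" and upper: "w e S \<le> wt e S + \<delta>" if "e \<in> \<Union>Rs" for e
    using decomposition[OF that S] deviation_nonneg[OF that S] deviation_le[OF that S]
    by simp_all
  have "route_cost wt S Rt_opt \<le> route_cost wt S R_opt"
    using surrogate_opt mem by (auto simp: is_arg_min_linorder)
  also have "\<dots> \<le> route_cost w S R_opt"
    using mem by (intro route_cost_mono lower) blast
  finally show "route_cost wt S Rt_opt \<le> route_cost w S R_opt" .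
  have "route_cost w S R_opt \<le> route_cost w S Rt_opt"
    using true_opt mem by (auto simp: is_arg_min_linorder)
  also have "\<dots> \<le> route_cost wt S Rt_opt + \<delta> * real (card Rt_opt)"
    using mem by (intro route_cost_le_add_card upper) blast
  finally show "route_cost w S R_opt \<le> route_cost wt S Rt_opt + \<delta> * real (card Rt_opt)" .
qed

end
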